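(* Let $(G,\circ)$ be a hyperquasigroup, let $IFSH(G)$ be the set of all intuitionistic fuzzy sub-hyperquasigroups of $G$, and let $S(G)$ be the set of all sub-hyperquasigroups of $G$. For $\alpha\in[0,1]$ define equivalence relations $\mathfrak{U}^{\alpha}$ and $\mathfrak{L}^{\alpha}$ on $IFSH(G)$ by $$(A,B)\in\mathfrak{U}^{\alpha}\iff U(\mu_A;\alpha)=U(\mu_B;\alpha),\qquad (A,B)\in\mathfrak{L}^{\alpha}\iff L(\lambda_A;\alpha)=L(\lambda_B;\alpha),$$ where $A=(\mu_A,\lambda_A)$ and $B=(\mu_B,\lambda_B)$. Then for every $\alpha\in(0,1)$ the quotient sets $IFSH(G)/\mathfrak{U}^{\alpha}$ and $IFSH(G)/\mathfrak{L}^{\alpha}$ are both equipotent (in bijection) to $S(G)\cup\{\emptyset\}$.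
   Context: A hypergroupoid $(G,\circ)$ is a non-empty set $G$ with a map $\circ$ from $G\times G$ to the non-empty subsets of $G$; for $A,B\subseteq G$, $A\circ B=\bigcup\{x\circ y : x\in A, y\in B\}$, $x\circ A=\{x\}\circ A$, $A\circ x=A\circ\{x\}$. It is a hyperquasigroup if $x\circ G=G\circ x=G$ for all $x\in G$. A non-empty subset $K\subseteq G$ is a sub-hyperquasigroup of $G$ if $(K,\circ)$ is a hyperquasigroup (so $x\circ y\subseteq K$ for $x,y\in K$ and $x\circ K=K\circ x=K$ for all $x\in K$). A fuzzy set in $G$ is a map $\mu:G\to[0,1]$. For $t\in[0,1]$, $U(\mu;t)=\{x\in G:\mu(x)\ge t\}$ and $L(\mu;t)=\{x\in G:\mu(x)\le t\}$. An intuitionistic fuzzy set $A=(\mu_A,\lambda_A)$ in $G$ is a pair of maps $\mu_A,\lambda_A:G\to[0,1]$ with $\mu_A(x)+\lambda_A(x)\le 1$ for all $x\in G$. An intuitionistic fuzzy set $A=(\mu_A,\lambda_A)$ in $G$ is an intuitionistic fuzzy sub-hyperquasigroup (IFSH) of $G$ if: (1) $\min\{\mu_A(x),\mu_A(y)\}\le\inf\{\mu_A(z): z\in x\circ y\}$ for all $x,y\in G$; (2) for all $x,a\in G$ there exist $y,z\in G$ with $x\in(a\circ y)\cap(z\circ a)$ and $\min\{\mu_A(a),\mu_A(x)\}\le\min\{\mu_A(y),\mu_A(z)\}$; (3) $\sup\{\lambda_A(z): z\in x\circ y\}\le\max\{\lambda_A(x),\lambda_A(y)\}$ for all $x,y\in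 G$; (4) for all $x,a\in G$ there exist $y,z\in G$ with $x\in(a\circ y)\cap(z\circ a)$ and $\max\{\lambda_A(y),\lambda_A(z)\}\le\max\{\lambda_A(a),\lambda_A(x)\}$. *)

theory Defs
  imports Complex_Main "HOL-Library.FuncSet" "HOL-Library.Equipollence"
begin

text \<open>
  The operation of a hypergroupoid with carrier \<open>G\<close> is a function \<open>h\<close> on the whole type;
  only its values on \<open>G \<times> G\<close> matter. A subset \<open>K\<close> therefore carries the same \<open>h\<close>.
\<close>

definition hypergroupoid :: "'a set \<Rightarrow> ('a \<Rightarrow> 'a \<Rightarrow> 'a set) \<Rightarrow> bool" where
  "hypergroupoid G h \<longleftrightarrow> G \<noteq> {} \<and> (\<forall>x\<in>G. \<forall>y\<in>G. h x y \<noteq> {} \<and> h x y \<subseteq> G)"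

definition set_hop :: "('a \<Rightarrow> 'a \<Rightarrow> 'a set) \<Rightarrow> 'a set \<Rightarrow> 'a set \<Rightarrow> 'a set" where
  "set_hop h A B = (\<Union>x\<in>A. \<Union>y\<in>B. h x y)"

definition hyperquasigroup :: "'a set \<Rightarrow> ('a \<Rightarrow> 'a \<Rightarrow> 'a set) \<Rightarrow> bool" where
  "hyperquasigroup G h \<longleftrightarrow>
     hypergroupoid G h \<and> (\<forall>x\<in>G. set_hop h {x} G = G \<and> set_hop h G {x} = G)"

definition sub_hyperquasigroups :: "'a set \<Rightarrow> ('a \<Rightarrow> 'a \<Rightarrow> 'a set) \<Rightarrow> 'a set set" where
  "sub_hyperquasigroups G h = {K. K \<noteq> {} \<and> K \<subseteq> G \<and> hyperquasigroup K h}"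

text \<open>
  Maps \<open>G \<rightarrow> [0,1]\<close> are represented by extensional functions, so that each map on \<open>G\<close>
  corresponds to exactly one HOL function.
\<close>

definition fuzzy_sets :: "'a set \<Rightarrow> ('a \<Rightarrow> real) set" where
  "fuzzy_sets G = G \<rightarrow>\<^sub>E {0..1}"

definition upper_level :: "'a set \<Rightarrow> ('a \<Rightarrow> real) \<Rightarrow> real \<Rightarrow> 'a set" where
  "upper_level G \<mu> t = {x \<in> G. \<mu> x \<ge> t}"

definition lower_level :: "'a set \<Rightarrow> ('a \<Rightarrow> real) \<Rightarrow> real \<Rightarrow> 'a set" where
  "lower_level G \<mu> t = {x \<in> G. \<mu> x \<le> t}"

definition intuitionistic_fuzzy_sets :: "'a set \<Rightarrow> (('a \<Rightarrow> real) \<times> ('a \<Rightarrow> real)) set" where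
  "intuitionistic_fuzzy_sets G =
     {(\<mu>, \<nu>). \<mu> \<in> fuzzy_sets G \<and> \<nu> \<in> fuzzy_sets G \<and> (\<forall>x\<in>G. \<mu> x + \<nu> x \<le> 1)}"

text \<open>
  Over a hypergroupoid the infima and suprema below range over non-empty subsets of \<open>[0,1]\<close>,
  so the conditionally complete operations on the reals are the intended ones.
\<close>

definition IFSH ::
  "'a set \<Rightarrow> ('a \<Rightarrow> 'a \<Rightarrow> 'a set) \<Rightarrow> (('a \<Rightarrow> real) \<times> ('a \<Rightarrow> real)) set" where
  "IFSH G h = {(\<mu>, \<nu>) \<in> intuitionistic_fuzzy_sets G.
     (\<forall>x\<in>G. \<forall>y\<in>G. min (\<mu> x) (\<mu> y) \<le> (INF z\<in>h x y. \<mu> z)) \<and>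
     (\<forall>x\<in>G. \<forall>a\<in>G. \<exists>y\<in>G. \<exists>z\<in>G. x \<in> h a y \<inter> h z a \<and>
        min (\<mu> a) (\<mu> x) \<le> min (\<mu> y) (\<mu> z)) \<and>
     (\<forall>x\<in>G. \<forall>y\<in>G. (SUP z\<in>h x y. \<nu> z) \<le> max (\<nu> x) (\<nu> y)) \<and>
     (\<forall>x\<in>G. \<forall>a\<in>G. \<exists>y\<in>G. \<exists>z\<in>G. x \<in> h a y \<inter> h z a \<and>
        max (\<nu> y) (\<nu> z) \<le> max (\<nu> a) (\<nu> x))}"

definition upper_rel ::
  "'a set \<Rightarrow> ('a \<Rightarrow> 'a \<Rightarrow> 'a set) \<Rightarrow> real \<Rightarrow> (('a \<Rightarrow> real) \<times> ('a \<Rightarrow> real)) rel" where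
  "upper_rel G h \<alpha> = {(A, B). A \<in> IFSH G h \<and> B \<in> IFSH G h \<and>
     upper_level G (fst A) \<alpha> = upper_level G (fst B) \<alpha>}"

definition lower_rel ::
  "'a set \<Rightarrow> ('a \<Rightarrow> 'a \<Rightarrow> 'a set) \<Rightarrow> real \<Rightarrow> (('a \<Rightarrow> real) \<times> ('a \<Rightarrow> real)) rel" where
  "lower_rel G h \<alpha> = {(A, B). A \<in> IFSH G h \<and> B \<in> IFSH G h \<and>
     lower_level G (snd A) \<alpha> = lower_level G (snd B) \<alpha>}"

lemma equiv_upper_rel: "equiv (IFSH G h) (upper_rel G h \<alpha>)"
  by (rule equivI) (auto simp: upper_rel_def refl_on_def sym_def trans_def)

lemma equiv_lower_rel: "equiv (IFSH G h) (lower_rel G h \<alpha>)"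
  by (rule equivI) (auto simp: lower_rel_def refl_on_def sym_def trans_def)

end

theory Submission imports Defs begin

text \<open>
  The classes of either relation correspond to the level sets at \<open>\<alpha>\<close>. Each level set is empty or a
  sub-hyperquasigroup, and conversely \<open>K\<close> is the \<open>\<alpha>\<close>-level set of the pair of the
  characteristic function of \<open>K\<close> and that of \<open>G - K\<close>, because \<open>0 < \<alpha> < 1\<close>.
\<close>

text \<open>The classes of a kernel relation are the fibres of \<open>f\<close> over its values.
  These fibres are non-empty, so different values have different fibres, and a class can be
  exchanged for the common value of \<open>f\<close> on it.\<close>

lemma quotient_kernel_eqpoll_image:
  "X // {(a, b). a \<in> X \<and> b \<in> X \<and> f a = f b} \<approx> f ` X" (is "X // ?r \<approx> _")
proof -
  let ?c = "\<lambda>v. {b \<in> X. v = f b}"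
  have "X // ?r = ?c ` f ` X"
    by (auto simp: quotient_def image_iff Image_def)
  moreover have "inj_on ?c (f ` X)"
    by (auto simp: inj_on_def)
  ultimately show ?thesis
    by (metis inj_on_image_eqpoll_self)
qed

text \<open>The equations \<open>a \<circ> K = K = K \<circ> a\<close> split into two inclusions:
  one is closure under the operation, the other is solvability of \<open>x \<in> h a y\<close> and
  \<open>x \<in> h z a\<close> inside \<open>K\<close>. Both conditions hold vacuously for the empty
  set, so this form treats it together with the sub-hyperquasigroups.\<close>

lemma sub_hyperquasigroups_or_empty_iff:
  assumes "hyperquasigroup G h"
  shows "K \<in> sub_hyperquasigroups G h \<union> {{}} \<longleftrightarrow>
    K \<subseteq> G \<and> (\<forall>x\<in>K. \<forall>y\<in>K. h x y \<subseteq> K) \<and>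
    (\<forall>x\<in>K. \<forall>a\<in>K. \<exists>y\<in>K. \<exists>z\<in>K. x \<in> h a y \<inter> h z a)" (is "_ \<longleftrightarrow> ?R")
proof
  assume "K \<in> sub_hyperquasigroups G h \<union> {{}}"
  then show ?R
    unfolding sub_hyperquasigroups_def hyperquasigroup_def hypergroupoid_def set_hop_def
    by auto blast+
next
  assume R: ?R
  \<comment> \<open>Closure puts both products inside \<open>K\<close>; for the reverse inclusions,
    \<open>y\<close> serves the left product and \<open>z\<close> the right one.\<close>
  have "set_hop h {a} K = K" "set_hop h K {a} = K" if "a \<in> K" for a
    using R that unfolding set_hop_def by (auto 0 3)
  moreover have "\<forall>x\<in>K. \<forall>y\<in>K. h x y \<noteq> {} \<and> h x y \<subseteq> K"
    using R assms unfolding hyperquasigroup_def hypergroupoid_def by blast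
  ultimately show "K \<in> sub_hyperquasigroups G h \<union> {{}}"
    using R unfolding sub_hyperquasigroups_def hyperquasigroup_def hypergroupoid_def by auto
qed

text \<open>If two elements have membership at least \<open>t\<close>, so does their minimum. The
  infimum condition then gives closure, and the solvability condition gives solutions that again
  have membership at least \<open>t\<close>.\<close>

lemma upper_level_IFSH:
  assumes G: "hyperquasigroup G h" and A: "(\<mu>, \<nu>) \<in> IFSH G h"
  shows "upper_level G \<mu> t \<in> sub_hyperquasigroups G h \<union> {{}}"
  unfolding sub_hyperquasigroups_or_empty_iff[OF G]
proof (intro conjI ballI)
  show "upper_level G \<mu> t \<subseteq> G"
    by (auto simp: upper_level_def)
next
  fix x y assume xy: "x \<in> upper_level G \<mu> t" "y \<in> upper_level G \<mu> t"
  then have h: "h x y \<subseteq> G"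
    using G by (auto simp: upper_level_def hyperquasigroup_def hypergroupoid_def)
  \<comment> \<open>An infimum of reals is known to be a lower bound only once the set is bounded
    below; here the values lie in \<open>{0..1}\<close>.\<close>
  have "bdd_below (\<mu> ` h x y)"
    using A h by (intro bdd_belowI2[where m = 0])
      (auto simp: IFSH_def intuitionistic_fuzzy_sets_def fuzzy_sets_def PiE_iff)
  then have "(INF z\<in>h x y. \<mu> z) \<le> \<mu> z" if "z \<in> h x y" for z
    using that by (rule cINF_lower)
  moreover have "t \<le> min (\<mu> x) (\<mu> y)"
    using xy by (simp add: upper_level_def)
  moreover have "min (\<mu> x) (\<mu> y) \<le> (INF z\<in>h x y. \<mu> z)"
    using A xy unfolding IFSH_def upper_level_def by blast
  ultimately show "h x y \<subseteq> upper_level G \<mu> t"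
    using h unfolding upper_level_def by (smt (verit) mem_Collect_eq subset_iff)
next
  fix x a assume "x \<in> upper_level G \<mu> t" "a \<in> upper_level G \<mu> t"
  then have "x \<in> G" "a \<in> G" and le: "t \<le> min (\<mu> a) (\<mu> x)"
    by (auto simp: upper_level_def)
  then obtain y z where "y \<in> G" "z \<in> G" "x \<in> h a y \<inter> h z a"
      "min (\<mu> a) (\<mu> x) \<le> min (\<mu> y) (\<mu> z)"
    using A unfolding IFSH_def by blast
  with le show "\<exists>y\<in>upper_level G \<mu> t. \<exists>z\<in>upper_level G \<mu> t. x \<in> h a y \<inter> h z a"
    unfolding upper_level_def by (intro bexI[of _ y] bexI[of _ z]) auto
qed

text \<open>Order dual of the argument for upper levels: the conditions on \<nu> bound the values on
  products, and at suitable solutions, by a maximum that is at most \<open>t\<close>.\<close>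

lemma lower_level_IFSH:
  assumes G: "hyperquasigroup G h" and A: "(\<mu>, \<nu>) \<in> IFSH G h"
  shows "lower_level G \<nu> t \<in> sub_hyperquasigroups G h \<union> {{}}"
  unfolding sub_hyperquasigroups_or_empty_iff[OF G]
proof (intro conjI ballI)
  show "lower_level G \<nu> t \<subseteq> G"
    by (auto simp: lower_level_def)
next
  fix x y assume xy: "x \<in> lower_level G \<nu> t" "y \<in> lower_level G \<nu> t"
  then have h: "h x y \<subseteq> G"
    using G by (auto simp: lower_level_def hyperquasigroup_def hypergroupoid_def)
  have "bdd_above (\<nu> ` h x y)"
    using A h by (intro bdd_aboveI2[where M = 1])
      (auto simp: IFSH_def intuitionistic_fuzzy_sets_def fuzzy_sets_def PiE_iff)
  then have "\<nu> z \<le> (SUP z\<in>h x y. \<nu> z)" if "z \<in> h x y" for z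
    using that by (rule cSUP_upper[rotated])
  moreover have "max (\<nu> x) (\<nu> y) \<le> t"
    using xy by (simp add: lower_level_def)
  moreover have "(SUP z\<in>h x y. \<nu> z) \<le> max (\<nu> x) (\<nu> y)"
    using A xy unfolding IFSH_def lower_level_def by blast
  ultimately show "h x y \<subseteq> lower_level G \<nu> t"
    using h unfolding lower_level_def by (smt (verit) mem_Collect_eq subset_iff)
next
  fix x a assume "x \<in> lower_level G \<nu> t" "a \<in> lower_level G \<nu> t"
  then have "x \<in> G" "a \<in> G" and le: "max (\<nu> a) (\<nu> x) \<le> t"
    by (auto simp: lower_level_def)
  then obtain y z where "y \<in> G" "z \<in> G" "x \<in> h a y \<inter> h z a"
      "max (\<nu> y) (\<nu> z) \<le> max (\<nu> a) (\<nu> x)"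
    using A unfolding IFSH_def by blast
  with le show "\<exists>y\<in>lower_level G \<nu> t. \<exists>z\<in>lower_level G \<nu> t. x \<in> h a y \<inter> h z a"
    unfolding lower_level_def by (intro bexI[of _ y] bexI[of _ z]) auto
qed

text \<open>The two components add up to exactly 1 on \<open>G\<close>. Restriction to
  \<open>G\<close> makes them extensional, as \<open>fuzzy_sets\<close> demands.\<close>

definition char_IFS :: "'a set \<Rightarrow> 'a set \<Rightarrow> ('a \<Rightarrow> real) \<times> ('a \<Rightarrow> real)" where
  "char_IFS G K = (\<lambda>x\<in>G. of_bool (x \<in> K), \<lambda>x\<in>G. of_bool (x \<notin> K))"

text \<open>With values 0 and 1 only, each inequality is trivial unless both given elements lie in
  \<open>K\<close>, and in that case it expresses closure of \<open>K\<close> or solvability within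
  \<open>K\<close>.\<close>

lemma char_IFS_in_IFSH:
  assumes G: "hyperquasigroup G h" and K: "K \<in> sub_hyperquasigroups G h \<union> {{}}"
  shows "char_IFS G K \<in> IFSH G h"
proof -
  define \<mu> \<nu> :: "'a \<Rightarrow> real"
    where "\<mu> = (\<lambda>x\<in>G. of_bool (x \<in> K))" and "\<nu> = (\<lambda>x\<in>G. of_bool (x \<notin> K))"
  have val: "\<mu> x = of_bool (x \<in> K)" "\<nu> x = of_bool (x \<notin> K)" if "x \<in> G" for x
    using that by (auto simp: \<mu>_def \<nu>_def)
  have KG: "K \<subseteq> G" and closed: "\<And>x y. x \<in> K \<Longrightarrow> y \<in> K \<Longrightarrow> h x y \<subseteq> K"
    and solv: "\<And>x a. x \<in> K \<Longrightarrow> a \<in> K \<Longrightarrow> \<exists>y\<in>K. \<exists>z\<in>K. x \<in> h a y \<inter> h z a"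
    using K unfolding sub_hyperquasigroups_or_empty_iff[OF G] by auto
  have hG: "h x y \<noteq> {}" "h x y \<subseteq> G" if "x \<in> G" "y \<in> G" for x y
    using G that by (auto simp: hyperquasigroup_def hypergroupoid_def)
  have solvG: "\<exists>y\<in>G. \<exists>z\<in>G. x \<in> h a y \<inter> h z a" if "x \<in> G" "a \<in> G" for x a
    using G that unfolding hyperquasigroup_def set_hop_def by blast
  \<comment> \<open>Solutions are taken in \<open>K\<close> when \<open>a\<close> and
    \<open>x\<close> both lie there, and anywhere in \<open>G\<close> otherwise. The same pair then
    serves the conditions on \<mu> and on \<nu>.\<close>
  have *: "\<exists>y\<in>G. \<exists>z\<in>G. x \<in> h a y \<inter> h z a \<and> (a \<in> K \<and> x \<in> K \<longrightarrow> y \<in> K \<and> z \<in> K)"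
    if "x \<in> G" "a \<in> G" for x a
    using solv[of x a] solvG[OF that] KG by blast
  have "(\<mu>, \<nu>) \<in> intuitionistic_fuzzy_sets G"
    by (auto simp: intuitionistic_fuzzy_sets_def fuzzy_sets_def \<mu>_def \<nu>_def)
  moreover have "min (\<mu> x) (\<mu> y) \<le> (INF z\<in>h x y. \<mu> z)" if "x \<in> G" "y \<in> G" for x y
    \<comment> \<open>Bounding the infimum from below pointwise requires \<open>h x y\<close> to be
      non-empty, which \<open>hG\<close> supplies.\<close>
    using hG[OF that] closed[of x y] that by (intro cINF_greatest) (auto simp: val subset_iff)
  moreover have "(SUP z\<in>h x y. \<nu> z) \<le> max (\<nu> x) (\<nu> y)" if "x \<in> G" "y \<in> G" for x y
    using hG[OF that] closed[of x y] that by (intro cSUP_least) (auto simp: val subset_iff)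
  moreover have "\<exists>y\<in>G. \<exists>z\<in>G. x \<in> h a y \<inter> h z a \<and> min (\<mu> a) (\<mu> x) \<le> min (\<mu> y) (\<mu> z)"
    "\<exists>y\<in>G. \<exists>z\<in>G. x \<in> h a y \<inter> h z a \<and> max (\<nu> y) (\<nu> z) \<le> max (\<nu> a) (\<nu> x)"
    if xa: "x \<in> G" "a \<in> G" for x a
  proof -
    obtain y z where yz: "y \<in> G" "z \<in> G" "x \<in> h a y \<inter> h z a"
        "a \<in> K \<and> x \<in> K \<longrightarrow> y \<in> K \<and> z \<in> K"
      using *[OF xa] by blast
    then have "min (\<mu> a) (\<mu> x) \<le> min (\<mu> y) (\<mu> z)" "max (\<nu> y) (\<nu> z) \<le> max (\<nu> a) (\<nu> x)"
      using xa by (auto simp: val)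
    with yz show "\<exists>y\<in>G. \<exists>z\<in>G. x \<in> h a y \<inter> h z a \<and> min (\<mu> a) (\<mu> x) \<le> min (\<mu> y) (\<mu> z)"
      "\<exists>y\<in>G. \<exists>z\<in>G. x \<in> h a y \<inter> h z a \<and> max (\<nu> y) (\<nu> z) \<le> max (\<nu> a) (\<nu> x)"
      by blast+
  qed
  ultimately have "(\<mu>, \<nu>) \<in> IFSH G h"
    unfolding IFSH_def by blast
  then show ?thesis
    by (simp add: char_IFS_def \<mu>_def \<nu>_def)
qed

text \<open>The threshold \<alpha> lies strictly between the two values: exactly the value 1 reaches
  it from above, and exactly the value 0 stays below it.\<close>

lemma level_char_IFS:
  assumes "K \<subseteq> G" "0 < \<alpha>" "\<alpha> < 1"
  shows "upper_level G (fst (char_IFS G K)) \<alpha> = K" "lower_level G (snd (char_IFS G K)) \<alpha> = K"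
  using assms by (auto simp: upper_level_def lower_level_def char_IFS_def of_bool_def split: if_splits)

theorem theorem3p2:
  fixes G :: "'a set" and h :: "'a \<Rightarrow> 'a \<Rightarrow> 'a set" and \<alpha> :: real
  assumes "hyperquasigroup G h"
    and "0 < \<alpha>" and "\<alpha> < 1"
  shows "IFSH G h // upper_rel G h \<alpha> \<approx> sub_hyperquasigroups G h \<union> {{}} \<and>
         IFSH G h // lower_rel G h \<alpha> \<approx> sub_hyperquasigroups G h \<union> {{}}"
proof -
  let ?S = "sub_hyperquasigroups G h \<union> {{}}"
  let ?u = "\<lambda>A. upper_level G (fst A) \<alpha>" and ?l = "\<lambda>A. lower_level G (snd A) \<alpha>"
  have char: "char_IFS G K \<in> IFSH G h" "?u (char_IFS G K) = K" "?l (char_IFS G K) = K"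
    if "K \<in> ?S" for K
    using char_IFS_in_IFSH[OF assms(1) that] level_char_IFS[OF _ assms(2,3), of K G] that
    by (auto simp: sub_hyperquasigroups_def)
  \<comment> \<open>The level-set lemma gives one inclusion; \<open>char_IFS G K\<close> is a
    preimage of \<open>K\<close> for the other.\<close>
  have "?u ` IFSH G h = ?S"
  proof
    show "?u ` IFSH G h \<subseteq> ?S"
      using upper_level_IFSH[OF assms(1), of "fst A" "snd A" \<alpha> for A]
      by (intro image_subsetI) simp
    show "?S \<subseteq> ?u ` IFSH G h"
    proof
      fix K assume "K \<in> ?S"
      from char[OF this] show "K \<in> ?u ` IFSH G h"
        by (intro image_eqI[of _ _ "char_IFS G K"]) simp_all
    qed
  qed
  moreover have "?l ` IFSH G h = ?S"
  proof
    show "?l ` IFSH G h \<subseteq> ?S"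
      using lower_level_IFSH[OF assms(1), of "fst A" "snd A" \<alpha> for A]
      by (intro image_subsetI) simp
    show "?S \<subseteq> ?l ` IFSH G h"
    proof
      fix K assume "K \<in> ?S"
      from char[OF this] show "K \<in> ?l ` IFSH G h"
        by (intro image_eqI[of _ _ "char_IFS G K"]) simp_all
    qed
  qed
  \<comment> \<open>Unfolded, the two relations are the kernels of \<open>?u\<close> and
    \<open>?l\<close> on \<open>IFSH G h\<close>, so the quotients are equipotent to the images just
    computed.\<close>
  ultimately show ?thesis
    using quotient_kernel_eqpoll_image[of "IFSH G h" ?u]
      quotient_kernel_eqpoll_image[of "IFSH G h" ?l]
    by (simp add: upper_rel_def lower_rel_def)
qed

end
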